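(* Let $G$ be a graph with $n$ vertices and $G\neq\overline{K_n}$ (i.e. $G$ has at least one edge). Then $$2\gamma(G)+1-n\le \gamma_{MR}(G)\le 2\gamma(G),$$ where $\gamma(G)$ is the domination number of $G$. These bounds are sharp: the lower bound is attained by the path $P_3$ and the upper bound by the cycle $C_3$.
   Context: All graphs are finite and simple. For a vertex $v$ of $G=(V,E)$, $N[v]=\{v\}\cup\{u: uv\in E\}$ is the closed neighborhood, and for $f:V\to\mathbb{R}$ and $S\subseteq V$, $f(S)=\sum_{x\in S}f(x)$. A majority Roman dominating function (MRDF) on $G$ is a function $f:V\to\{-1,1,2\}$ such that (i) $f(N[v])\ge 1$ for at least half of the vertices $v\in V$, and (ii) every vertex $u$ with $f(u)=-1$ is adjacent to at least one vertex $w$ with $f(w)=2$. The weight of $f$ is $f(V)$, and the majority Roman domination number $\gamma_{MR}(G)$ is the minimum weight of an MRDF on $G$. The domination number $\gamma(G)$ is the minimum cardinality of a set $S\subseteq V$ such that every vertex of $V\setminus S$ is adjacent to a vertex of $S$. *)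

theory Defs
  imports "Graph_Theory.Pair_Digraph"
begin

text \<open>
  Finite simple graphs are the records satisfying the locale predicate \<open>pair_graph\<close>:
  finite vertex set \<open>pverts G\<close>, symmetric loop-free arc set \<open>parcs G\<close>.  An undirected edge
  \<open>uv\<close> is thus represented by the two arcs \<open>(u, v)\<close> and \<open>(v, u)\<close>.
\<close>

definition closed_nbhd :: "'a pair_pre_digraph \<Rightarrow> 'a \<Rightarrow> 'a set" where
  "closed_nbhd G v = insert v {u. (u, v) \<in> parcs G}"

definition dominating_set :: "'a pair_pre_digraph \<Rightarrow> 'a set \<Rightarrow> bool" where
  "dominating_set G S \<longleftrightarrow>
     S \<subseteq> pverts G \<and> (\<forall>v \<in> pverts G - S. \<exists>u \<in> S. (v, u) \<in> parcs G)"

definition domination_number :: "'a pair_pre_digraph \<Rightarrow> nat" where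
  "domination_number G = Min (card ` {S. dominating_set G S})"

text \<open>
  Functions on the vertex set are total functions whose values outside \<open>pverts G\<close> are
  irrelevant.
\<close>

definition MRDF :: "'a pair_pre_digraph \<Rightarrow> ('a \<Rightarrow> int) \<Rightarrow> bool" where
  "MRDF G f \<longleftrightarrow>
     f \<in> pverts G \<rightarrow> {-1, 1, 2} \<and>
     2 * card {v \<in> pverts G. sum f (closed_nbhd G v) \<ge> 1} \<ge> card (pverts G) \<and>
     (\<forall>u \<in> pverts G. f u = -1 \<longrightarrow> (\<exists>w \<in> pverts G. (u, w) \<in> parcs G \<and> f w = 2))"

definition MR_domination_number :: "'a pair_pre_digraph \<Rightarrow> int" where
  "MR_domination_number G = Min {sum f (pverts G) | f. MRDF G f}"

definition path_graph :: "nat \<Rightarrow> nat pair_pre_digraph" where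
  "path_graph n = \<lparr>pverts = {..<n},
     parcs = {(i, j). i < n \<and> j < n \<and> (j = Suc i \<or> i = Suc j)}\<rparr>"

text \<open>Only meaningful for \<open>n \<ge> 3\<close>.\<close>

definition cycle_graph :: "nat \<Rightarrow> nat pair_pre_digraph" where
  "cycle_graph n = \<lparr>pverts = {..<n},
     parcs = {(i, j). i < n \<and> j < n \<and> (j = Suc i mod n \<or> i = Suc j mod n)}\<rparr>"

text \<open>The two minima range over finite nonempty sets, and the two example families are graphs.\<close>

lemma domination_number_wf:
  assumes "pair_graph G"
  shows "finite (card ` {S. dominating_set G S})" "card ` {S. dominating_set G S} \<noteq> {}"
proof -
  interpret pair_graph G by fact
  have "{S. dominating_set G S} \<subseteq> Pow (pverts G)" by (auto simp: dominating_set_def)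
  then show "finite (card ` {S. dominating_set G S})"
    using pair_finite_verts by (meson finite_Pow_iff finite_imageI finite_subset)
  have "dominating_set G (pverts G)" by (auto simp: dominating_set_def)
  then show "card ` {S. dominating_set G S} \<noteq> {}" by auto
qed

lemma MR_domination_number_wf:
  assumes "pair_graph G"
  shows "finite {sum f (pverts G) | f. MRDF G f}" "{sum f (pverts G) | f. MRDF G f} \<noteq> {}"
proof -
  interpret pair_graph G by fact
  have "sum f (pverts G) \<in> {- int (card (pverts G)) .. 2 * int (card (pverts G))}"
    if "MRDF G f" for f
  proof -
    have "f v \<in> {-1, 1, 2}" if "v \<in> pverts G" for v
      using that \<open>MRDF G f\<close> by (auto simp: MRDF_def Pi_def)
    then have b: "-1 \<le> f v \<and> f v \<le> 2" if "v \<in> pverts G" for v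
      using that by fastforce
    show ?thesis
      using sum_bounded_below[of "pverts G" "-1" f] sum_bounded_above[of "pverts G" f 2] b
      by auto
  qed
  then have "{sum f (pverts G) | f. MRDF G f} \<subseteq>
      {- int (card (pverts G)) .. 2 * int (card (pverts G))}" by blast
  then show "finite {sum f (pverts G) | f. MRDF G f}"
    by (rule finite_subset) simp
  have "sum (\<lambda>_. 1 :: int) (closed_nbhd G v) \<ge> 1" if "v \<in> pverts G" for v
  proof -
    have "closed_nbhd G v \<subseteq> pverts G"
      using that by (auto simp: closed_nbhd_def dest: in_arcsD1)
    then have "finite (closed_nbhd G v)"
      using pair_finite_verts by (rule finite_subset)
    moreover have "v \<in> closed_nbhd G v" by (simp add: closed_nbhd_def)
    ultimately have "card (closed_nbhd G v) > 0" by (auto simp: card_gt_0_iff)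
    then show ?thesis by simp
  qed
  then have "{v \<in> pverts G. sum (\<lambda>_. 1 :: int) (closed_nbhd G v) \<ge> 1} = pverts G" by blast
  then have "MRDF G (\<lambda>_. 1)" by (simp add: MRDF_def del: sum_constant)
  then show "{sum f (pverts G) | f. MRDF G f} \<noteq> {}" by blast
qed

lemma pair_graph_path_graph: "pair_graph (path_graph n)"
proof -
  have "parcs (path_graph n) \<subseteq> {..<n} \<times> {..<n}" by (auto simp: path_graph_def)
  then have "finite (parcs (path_graph n))" by (rule finite_subset) simp
  then show ?thesis
    by unfold_locales (auto simp: path_graph_def symmetric_def arcs_ends_conv sym_def)
qed

lemma pair_graph_cycle_graph:
  assumes "n \<ge> 3"
  shows "pair_graph (cycle_graph n)"
proof -
  have "parcs (cycle_graph n) \<subseteq> {..<n} \<times> {..<n}" by (auto simp: cycle_graph_def)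
  then have "finite (parcs (cycle_graph n))" by (rule finite_subset) simp
  moreover have "Suc i mod n \<noteq> i" if "i < n" for i
    using that assms by (cases "Suc i = n") auto
  ultimately show ?thesis
    by unfold_locales (fastforce simp: cycle_graph_def symmetric_def arcs_ends_conv sym_def)+
qed

end

theory Submission
  imports Defs
begin

text \<open>
  Upper bound: give a minimum dominating set \<open>S\<close> the value 2 and split its complement into disjoint
  sets \<open>P\<close>, \<open>Q\<close> of equal size and at most one further vertex.  Letting either \<open>P\<close> or \<open>Q\<close> carry
  the value 1, and all remaining vertices the value -1, produces two functions of weight at most
  \<open>2 |S|\<close>.  Outside \<open>S\<close> they add up to at least -2 over any set, so at each vertex one of them has
  a closed neighbourhood sum at least \<open>2 - 1\<close>; hence one of the two is good at half of the vertices.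

  Lower bound: the vertices with positive value form a dominating set, and \<open>f + 1\<close> is at least 2 on
  it, is 0 elsewhere, and is 3 somewhere unless \<open>f\<close> is constantly 1.
\<close>

section \<open>Minimality and attainment for the two graph parameters\<close>

lemma domination_number_le:
  assumes "pair_graph G" "dominating_set G S"
  shows "domination_number G \<le> card S"
  unfolding domination_number_def
  using assms by (intro Min_le domination_number_wf) auto

lemma domination_number_attained:
  assumes "pair_graph G"
  obtains S where "dominating_set G S" "card S = domination_number G"
  using Min_in[OF domination_number_wf[OF assms]] unfolding domination_number_def by auto

lemma MR_domination_number_le:
  assumes "pair_graph G" "MRDF G f"
  shows "MR_domination_number G \<le> sum f (pverts G)"
  unfolding MR_domination_number_def
  using assms by (intro Min_le MR_domination_number_wf) auto

lemma MR_domination_number_attained: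
  assumes "pair_graph G"
  obtains f where "MRDF G f" "sum f (pverts G) = MR_domination_number G"
  using Min_in[OF MR_domination_number_wf[OF assms]] unfolding MR_domination_number_def by auto

lemma closed_nbhd_subset:
  assumes "pair_graph G" "v \<in> pverts G"
  shows "closed_nbhd G v \<subseteq> pverts G"
proof -
  interpret pair_graph G by fact
  show ?thesis using assms by (auto simp: closed_nbhd_def dest: in_arcsD1)
qed

text \<open>\<open>closed_nbhd\<close> collects arcs entering a vertex, while
  \<open>dominating_set\<close> asks for arcs leaving it; symmetry reconciles the two.\<close>

lemma parcs_sym:
  assumes "pair_graph G" "(u, v) \<in> parcs G"
  shows "(v, u) \<in> parcs G"
proof -
  interpret pair_graph G by fact
  show ?thesis using assms(2) by (rule arcs_symmetric)
qed

section \<open>Upper bound: the functions built from a dominating set\<close>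

lemma disjoint_halves:
  assumes "finite U"
  obtains P Q where "P \<subseteq> U" "Q \<subseteq> U" "P \<inter> Q = {}" "2 * card P \<le> card U" "2 * card Q \<le> card U"
    "card (U - (P \<union> Q)) \<le> 1"
proof -
  obtain P where P: "P \<subseteq> U" "card P = card U div 2" "finite P"
    using obtain_subset_with_card_n[of "card U div 2" U] by auto
  have cUP: "card (U - P) = card U - card U div 2"
    using P by (simp add: card_Diff_subset)
  moreover have "card U div 2 \<le> card U - card U div 2" by linarith
  ultimately obtain Q where Q: "Q \<subseteq> U - P" "card Q = card U div 2" "finite Q"
    using obtain_subset_with_card_n[of "card U div 2" "U - P"] by metis
  have "U - (P \<union> Q) = U - P - Q" by blast
  then have "card (U - (P \<union> Q)) = card (U - P) - card Q"
    using Q by (simp add: card_Diff_subset)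
  \<comment> \<open>Both \<open>P\<close> and \<open>Q\<close> have \<open>card U div 2\<close>
    elements, so the remainder has \<open>card U mod 2\<close>.\<close>
  then have "card (U - (P \<union> Q)) \<le> 1" using cUP Q by linarith
  with P Q show thesis by (intro that[of P Q]) auto
qed

definition dom_fun :: "'a set \<Rightarrow> 'a set \<Rightarrow> 'a \<Rightarrow> int" where
  "dom_fun S P v = (if v \<in> S then 2 else if v \<in> P then 1 else -1)"

text \<open>Outside \<open>S\<close> the values add up to \<open>card P - card (V - S - P)\<close>,
  which is not positive because \<open>P\<close> is at most half of \<open>V - S\<close>.\<close>

lemma sum_dom_fun_le:
  assumes "finite V" "S \<subseteq> V" "P \<subseteq> V - S" "2 * card P \<le> card (V - S)"
  shows "sum (dom_fun S P) V \<le> 2 * int (card S)"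
proof -
  have fin: "finite S" "finite P" "finite (V - S - P)"
    using assms finite_subset by blast+
  have "V = S \<union> (P \<union> (V - S - P))" using assms by blast
  then have "sum (dom_fun S P) V = sum (dom_fun S P) (S \<union> (P \<union> (V - S - P)))" by simp
  also have "\<dots> = sum (dom_fun S P) S + (sum (dom_fun S P) P + sum (dom_fun S P) (V - S - P))"
    using fin assms by (subst sum.union_disjoint; (subst sum.union_disjoint)?) auto
  also have "sum (dom_fun S P) S = 2 * int (card S)"
    by (simp add: dom_fun_def)
  also have "sum (dom_fun S P) P = (\<Sum>v\<in>P. 1)"
    using assms by (intro sum.cong) (auto simp: dom_fun_def)
  also have "sum (dom_fun S P) (V - S - P) = (\<Sum>v\<in>V - S - P. -1)"
    by (intro sum.cong) (auto simp: dom_fun_def)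
  finally have "sum (dom_fun S P) V = 2 * int (card S) + int (card P) - int (card (V - S - P))"
    by simp
  moreover have "card (V - S - P) = card (V - S) - card P"
    using assms fin by (simp add: card_Diff_subset)
  ultimately show ?thesis
    using assms(4) by linarith
qed

text \<open>The sum of the two functions is 4 on \<open>S\<close>, 0 on the rest of
  \<open>P \<union> Q\<close> and -2 elsewhere. Over \<open>N\<close> it is at least 4 - 2 = 2, so
  the two integer sums cannot both be at most 0.\<close>

lemma sum_dom_fun_ge_1:
  assumes "finite N" "N \<inter> S \<noteq> {}" "P \<inter> Q = {}" "card (N - S - (P \<union> Q)) \<le> 1"
  shows "sum (dom_fun S P) N \<ge> 1 \<or> sum (dom_fun S Q) N \<ge> 1"
proof -
  let ?g = "\<lambda>v. if v \<in> S then 4 else if v \<in> P \<union> Q then 0 else (-2 :: int)"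
  have "sum (dom_fun S P) N + sum (dom_fun S Q) N = sum ?g N"
    unfolding sum.distrib[symmetric] using assms(3)
    by (intro sum.cong) (auto simp: dom_fun_def)
  also have "\<dots> = sum ?g (N \<inter> S) + sum ?g (N - S)"
    using assms(1) by (rule sum.Int_Diff)
  also have "sum ?g (N \<inter> S) = 4 * int (card (N \<inter> S))"
    by (simp add: Int_def)
  also have "sum ?g (N - S) = sum ?g (N - S - (P \<union> Q))"
    using assms(1) by (intro sum.mono_neutral_right) auto
  also have "\<dots> = (\<Sum>v\<in>N - S - (P \<union> Q). -2)"
    by (intro sum.cong) auto
  finally have "sum (dom_fun S P) N + sum (dom_fun S Q) N
      = 4 * int (card (N \<inter> S)) - 2 * int (card (N - S - (P \<union> Q)))"
    by simp
  moreover have "card (N \<inter> S) \<ge> 1"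
    using assms(1,2) by (simp add: Suc_le_eq card_gt_0_iff)
  ultimately show ?thesis using assms(4) by linarith
qed

text \<open>Only vertices outside \<open>S\<close> get -1, and domination gives each of them a
  neighbour in \<open>S\<close>, where the value is 2. Thus only the majority condition has to be
  assumed.\<close>

lemma MRDF_dom_fun:
  assumes "dominating_set G S"
    and "2 * card {v \<in> pverts G. sum (dom_fun S P) (closed_nbhd G v) \<ge> 1} \<ge> card (pverts G)"
  shows "MRDF G (dom_fun S P)"
proof -
  have "\<exists>w\<in>pverts G. (u, w) \<in> parcs G \<and> dom_fun S P w = 2"
    if "u \<in> pverts G" "dom_fun S P u = -1" for u
  proof -
    have "u \<in> pverts G - S" using that by (auto simp: dom_fun_def)
    moreover have "\<forall>v\<in>pverts G - S. \<exists>w\<in>S. (v, w) \<in> parcs G"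
      using assms(1) by (simp add: dominating_set_def)
    ultimately obtain w where "w \<in> S" "(u, w) \<in> parcs G" by metis
    moreover have "S \<subseteq> pverts G" using assms(1) by (simp add: dominating_set_def)
    ultimately show ?thesis by (intro bexI[of _ w]) (auto simp: dom_fun_def)
  qed
  moreover have "dom_fun S P \<in> pverts G \<rightarrow> {-1, 1, 2}"
    by (simp add: dom_fun_def)
  ultimately show ?thesis
    using assms(2) unfolding MRDF_def by blast
qed

lemma MR_domination_number_upper:
  assumes "pair_graph G"
  shows "MR_domination_number G \<le> 2 * int (domination_number G)"
proof -
  interpret pair_graph G by fact
  let ?V = "pverts G"
  obtain S where S: "dominating_set G S" "card S = domination_number G"
    using domination_number_attained[OF assms] .
  have SV: "S \<subseteq> ?V" using S by (simp add: dominating_set_def)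
  obtain P Q where PQ: "P \<subseteq> ?V - S" "Q \<subseteq> ?V - S" "P \<inter> Q = {}"
    "2 * card P \<le> card (?V - S)" "2 * card Q \<le> card (?V - S)" "card (?V - S - (P \<union> Q)) \<le> 1"
    using disjoint_halves[of "?V - S"] by auto
  define A where "A R = {v \<in> ?V. sum (dom_fun S R) (closed_nbhd G v) \<ge> 1}" for R
  have "v \<in> A P \<union> A Q" if v: "v \<in> ?V" for v
  proof -
    let ?N = "closed_nbhd G v"
    have N: "?N \<subseteq> ?V" using closed_nbhd_subset[OF assms v] .
    have "?N \<inter> S \<noteq> {}"
      using S v parcs_sym[OF assms] unfolding dominating_set_def closed_nbhd_def by blast
    moreover have "card (?N - S - (P \<union> Q)) \<le> card (?V - S - (P \<union> Q))"
      using N by (intro card_mono) auto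
    ultimately show ?thesis
      using sum_dom_fun_ge_1[of ?N S P Q] PQ v N finite_subset[OF N] by (auto simp: A_def)
  qed
  then have "card ?V \<le> card (A P \<union> A Q)"
    by (intro card_mono) (auto simp: A_def)
  also have "\<dots> \<le> card (A P) + card (A Q)" by (rule card_Un_le)
  finally have "card ?V \<le> 2 * card (A P) \<or> card ?V \<le> 2 * card (A Q)" by linarith
  then obtain R where "R \<subseteq> ?V - S" "2 * card R \<le> card (?V - S)" "card ?V \<le> 2 * card (A R)"
    using PQ by blast
  then have "MRDF G (dom_fun S R)" "sum (dom_fun S R) ?V \<le> 2 * int (card S)"
    using MRDF_dom_fun[OF S(1), of R] sum_dom_fun_le[of ?V S R] SV by (auto simp: A_def)
  then show ?thesis
    using MR_domination_number_le[OF assms] S(2) by fastforce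
qed

section \<open>Lower bound\<close>

lemma domination_number_less_card:
  assumes "pair_graph G" "parcs G \<noteq> {}"
  shows "domination_number G < card (pverts G)"
proof -
  interpret pair_graph G by fact
  obtain u v where uv: "(u, v) \<in> parcs G" using assms(2) by auto
  then have "u \<in> pverts G" "v \<in> pverts G" "u \<noteq> v"
    by (auto dest: in_arcsD1 in_arcsD2 no_loops)
  \<comment> \<open>The only vertex left out is \<open>u\<close>, and its neighbour \<open>v\<close>
    stays in the set.\<close>
  moreover from this uv have "dominating_set G (pverts G - {u})"
    by (auto simp: dominating_set_def)
  ultimately have "domination_number G \<le> card (pverts G - {u})"
    using domination_number_le[OF assms(1)] by blast
  also have "\<dots> < card (pverts G)"
    using \<open>u \<in> pverts G\<close> by (intro psubset_card_mono) auto
  finally show ?thesis .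
qed

lemma MRDF_weight_ge:
  assumes "pair_graph G" "parcs G \<noteq> {}" "MRDF G f"
  shows "2 * int (domination_number G) + 1 - int (card (pverts G)) \<le> sum f (pverts G)"
proof -
  interpret pair_graph G by fact
  let ?V = "pverts G"
  have f: "f v \<in> {-1, 1, 2}" if "v \<in> ?V" for v
    using assms(3) that by (auto simp: MRDF_def)
  have nbr: "\<exists>w\<in>?V. (u, w) \<in> parcs G \<and> f w = 2" if "u \<in> ?V" "f u = -1" for u
    using assms(3) that by (auto simp: MRDF_def)
  show ?thesis
  proof (cases "\<exists>w\<in>?V. f w = 2")
    \<comment> \<open>Without the value 2 there can be no -1, so the weight is the number of
      vertices. The strict inequality \<open>domination_number G < card (pverts G)\<close> is what
      an edge provides: in an edgeless graph the claimed bound would exceed this weight by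
      1.\<close>
    case False
    then have "f v = 1" if "v \<in> ?V" for v
      using f[OF that] nbr[OF that] that by auto
    then have "sum f ?V = int (card ?V)" by simp
    then show ?thesis
      using domination_number_less_card[OF assms(1,2)] by linarith
  next
    case True
    then obtain w where w: "w \<in> ?V" "f w = 2" by blast
    define S where "S = {v \<in> ?V. f v \<noteq> -1}"
    \<comment> \<open>A vertex outside \<open>S\<close> has value -1, and its neighbour of value 2
      lies in \<open>S\<close>.\<close>
    have "dominating_set G S"
      using nbr unfolding dominating_set_def S_def by fastforce
    then have dom: "domination_number G \<le> card S" by (rule domination_number_le[OF assms(1)])
    have wS: "w \<in> S" "finite S" using w by (auto simp: S_def)
    \<comment> \<open>Shifting by 1 removes the vertices of value -1. Then \<open>w\<close>
      contributes 3 and every other vertex of \<open>S\<close> at least 2, in total at least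
      \<open>2 * card S + 1\<close>; the extra 1 in the bound comes from \<open>w\<close>.\<close>
    have "sum f ?V + int (card ?V) = (\<Sum>v\<in>?V. f v + 1)" by (simp add: sum.distrib)
    also have "\<dots> = (\<Sum>v\<in>S. f v + 1)"
      by (intro sum.mono_neutral_right) (auto simp: S_def)
    also have "\<dots> = 3 + (\<Sum>v\<in>S - {w}. f v + 1)" (is "_ = 3 + ?s")
      using wS w by (simp add: sum.remove)
    finally have "sum f ?V + int (card ?V) = 3 + ?s" .
    moreover have "(\<Sum>v\<in>S - {w}. 2) \<le> ?s"
      using f by (intro sum_mono) (force simp: S_def)
    ultimately show ?thesis
      using card_Suc_Diff1[OF wS(2,1)] dom by simp
  qed
qed

lemma MR_domination_number_lower:
  assumes "pair_graph G" "parcs G \<noteq> {}"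
  shows "2 * int (domination_number G) + 1 - int (card (pverts G)) \<le> MR_domination_number G"
proof -
  obtain f where f: "MRDF G f" "sum f (pverts G) = MR_domination_number G"
    using MR_domination_number_attained[OF assms(1)] .
  then show ?thesis using MRDF_weight_ge[OF assms f(1)] by simp
qed

section \<open>Sharpness: the path and the cycle on three vertices\<close>

lemma domination_number_eq_1:
  assumes "pair_graph G" "dominating_set G {v}"
  shows "domination_number G = 1"
proof -
  interpret pair_graph G by fact
  obtain S where S: "dominating_set G S" "card S = domination_number G"
    using domination_number_attained[OF assms(1)] .
  \<comment> \<open>The graph contains \<open>v\<close>, so the empty set does not dominate it.
    Finiteness matters because \<open>card\<close> is 0 on infinite sets.\<close>
  then have "S \<noteq> {}" "finite S"
    using assms(2) finite_subset[OF _ pair_finite_verts] by (auto simp: dominating_set_def)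
  then have "card S \<noteq> 0" by simp
  then show ?thesis using S(2) domination_number_le[OF assms] by simp
qed

lemma lessThan_3: "{..<3 :: nat} = {0, 1, 2}"
  by auto

lemma path_graph_3: "path_graph 3 = \<lparr>pverts = {0, 1, 2}, parcs = {(0,1), (1,0), (1,2), (2,1)}\<rparr>"
  unfolding path_graph_def by (auto simp: lessThan_3)

text \<open>The modular adjacency is decided on the nine pairs over \<open>{0, 1, 2}\<close>;
  \<open>pairs_eq\<close> turns this finite check into an equality of arc sets.\<close>

lemma cycle_graph_3:
  "cycle_graph 3 = \<lparr>pverts = {0, 1, 2}, parcs = {(0,1), (1,0), (1,2), (2,1), (2,0), (0,2)}\<rparr>"
proof -
  let ?E = "{(0,1), (1,0), (1,2), (2,1), (2,0), (0,2)} :: (nat \<times> nat) set"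
  have arcs: "\<forall>i\<in>{..<3}. \<forall>j\<in>{..<3}. (j = Suc i mod 3 \<or> i = Suc j mod 3) \<longleftrightarrow> (i, j) \<in> ?E"
    unfolding lessThan_3 by simp
  have sub: "?E \<subseteq> {..<3} \<times> {..<3}" by simp
  have pairs_eq: "{(i, j). i < n \<and> j < n \<and> R i j} = E"
    if "\<forall>i\<in>{..<n}. \<forall>j\<in>{..<n}. R i j \<longleftrightarrow> (i, j) \<in> E" "E \<subseteq> {..<n} \<times> {..<n}"
    for n :: nat and R E using that by auto
  have "{(i, j). i < 3 \<and> j < 3 \<and> (j = Suc i mod 3 \<or> i = Suc j mod 3)} = ?E"
    by (rule pairs_eq[OF arcs sub])
  then show ?thesis by (simp only: cycle_graph_def lessThan_3)
qed

lemma domination_number_path_graph_3: "domination_number (path_graph 3) = 1"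
  by (rule domination_number_eq_1[OF pair_graph_path_graph, of _ 1])
    (auto simp: dominating_set_def path_graph_3)

lemma domination_number_cycle_graph_3: "domination_number (cycle_graph 3) = 1"
  by (rule domination_number_eq_1[OF pair_graph_cycle_graph, of _ 1])
    (auto simp: dominating_set_def cycle_graph_3)

text \<open>The witness puts 2 on the centre and -1 on both ends. The ends have neighbourhood sum 1
  and already form a majority, although the centre has sum 0. The general lower bound 2 + 1 - 3 = 0
  matches this weight.\<close>

lemma MR_domination_number_path_graph_3: "MR_domination_number (path_graph 3) = 0"
proof -
  let ?G = "path_graph 3" and ?f = "(\<lambda>_. -1)(1 := 2) :: nat \<Rightarrow> int"
  have nb: "closed_nbhd ?G 0 = {0, 1}" "closed_nbhd ?G 2 = {1, 2}"
    by (auto simp: closed_nbhd_def path_graph_3)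
  have "{0, 2} \<subseteq> {v \<in> pverts ?G. sum ?f (closed_nbhd ?G v) \<ge> 1}"
    by (auto simp: nb) (auto simp: path_graph_3)
  then have "card {0, 2 :: nat} \<le> card {v \<in> pverts ?G. sum ?f (closed_nbhd ?G v) \<ge> 1}"
    by (intro card_mono) (auto simp: path_graph_3)
  then have "MRDF ?G ?f" by (auto simp: MRDF_def path_graph_3)
  then have "MR_domination_number ?G \<le> sum ?f (pverts ?G)"
    by (rule MR_domination_number_le[OF pair_graph_path_graph])
  then have "MR_domination_number ?G \<le> 0" by (simp add: path_graph_3)
  moreover have "0 \<le> MR_domination_number ?G"
    using MR_domination_number_lower[OF pair_graph_path_graph, of 3] domination_number_path_graph_3
    by (simp add: path_graph_3)
  ultimately show ?thesis by simp
qed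

text \<open>Every closed neighbourhood in the triangle is the whole vertex set, so a single good
  vertex forces weight at least 1. Excluding weight 1 leaves the value of the general upper
  bound.\<close>

lemma MR_domination_number_cycle_graph_3: "MR_domination_number (cycle_graph 3) = 2"
proof -
  let ?G = "cycle_graph 3"
  have G: "pair_graph ?G" by (simp add: pair_graph_cycle_graph)
  obtain f where f: "MRDF ?G f" "sum f (pverts ?G) = MR_domination_number ?G"
    using MR_domination_number_attained[OF G] .
  have nb: "closed_nbhd ?G v = pverts ?G" if "v \<in> pverts ?G" for v
    using that by (auto simp: closed_nbhd_def cycle_graph_3)
  have "card (pverts ?G) \<le> 2 * card {v \<in> pverts ?G. sum f (closed_nbhd ?G v) \<ge> 1}"
    using f(1) unfolding MRDF_def by blast
  moreover have "card (pverts ?G) = 3" by (simp add: cycle_graph_3)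
  ultimately have "{v \<in> pverts ?G. sum f (closed_nbhd ?G v) \<ge> 1} \<noteq> {}"
    by (metis card.empty le_zero_eq mult_0_right zero_neq_numeral)
  then obtain v where "v \<in> pverts ?G" "sum f (closed_nbhd ?G v) \<ge> 1" by blast
  then have "sum f (pverts ?G) \<ge> 1" by (simp only: nb)
  then have sum_ge: "f 0 + f 1 + f 2 \<ge> 1" by (simp add: cycle_graph_3)
  have "f v \<in> {-1, 1, 2}" if "v \<in> {0, 1, 2}" for v
    using f(1) that unfolding MRDF_def cycle_graph_3 by auto
  then have vals: "f 0 \<in> {-1, 1, 2}" "f 1 \<in> {-1, 1, 2}" "f 2 \<in> {-1, 1, 2}" by simp_all
  have "f 0 = 2 \<or> f 1 = 2 \<or> f 2 = 2" if "f u = -1" "u \<in> {0, 1, 2}" for u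
  proof -
    have "\<exists>w\<in>pverts ?G. f w = 2"
      using f(1) that unfolding MRDF_def cycle_graph_3 pair_pre_digraph.simps by blast
    then show ?thesis by (simp add: cycle_graph_3)
  qed
  then have two: "f 0 = -1 \<or> f 1 = -1 \<or> f 2 = -1 \<Longrightarrow> f 0 = 2 \<or> f 1 = 2 \<or> f 2 = 2" by blast
  \<comment> \<open>Three values from \<open>{-1, 1, 2}\<close> have sum 1 only as 1 + 1 - 1, and
    there the vertex of value -1 has no neighbour of value 2.\<close>
  have "f 0 + f 1 + f 2 \<ge> 2"
    using sum_ge vals two by (smt (verit) insert_iff empty_iff)
  then have "MR_domination_number ?G \<ge> 2" using f(2) by (simp add: cycle_graph_3)
  with MR_domination_number_upper[OF G] show ?thesis
    by (simp add: domination_number_cycle_graph_3)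
qed

theorem proposition2:
  shows "(\<forall>G :: 'a pair_pre_digraph. pair_graph G \<longrightarrow> parcs G \<noteq> {} \<longrightarrow>
            2 * int (domination_number G) + 1 - int (card (pverts G)) \<le> MR_domination_number G \<and>
            MR_domination_number G \<le> 2 * int (domination_number G)) \<and>
         MR_domination_number (path_graph 3) =
            2 * int (domination_number (path_graph 3)) + 1 - int (card (pverts (path_graph 3))) \<and>
         MR_domination_number (cycle_graph 3) = 2 * int (domination_number (cycle_graph 3))"
proof (intro conjI allI impI)
  show "MR_domination_number (path_graph 3) =
      2 * int (domination_number (path_graph 3)) + 1 - int (card (pverts (path_graph 3)))"
    unfolding MR_domination_number_path_graph_3 domination_number_path_graph_3
    by (simp add: path_graph_3)
  show "MR_domination_number (cycle_graph 3) = 2 * int (domination_number (cycle_graph 3))"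
    by (simp add: MR_domination_number_cycle_graph_3 domination_number_cycle_graph_3)
qed (simp_all add: MR_domination_number_lower MR_domination_number_upper)

end
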